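(* Let $D$ be a digraph. If the orientation of $D$ is acyclic (i.e. $D$ contains no directed cycle), or if $D$ is clique-acyclic and its underlying undirected graph is perfect, then $\gamma(D)\le\alpha(D)$.
   Context: Digraphs are finite and loopless; $E(D)$ is the set of directed edges. A digraph $D$ is clique-acyclic if it has no directed (cyclic) triangle, i.e. no three vertices $u,v,w$ with $(u,v),(v,w),(w,u)\in E(D)$. $\alpha(D)$ is the maximum size of an independent set of $D$, i.e. of a set of vertices with no edge (in either direction) between any two of them. $\gamma(D)$ is the domination number of $D$: the smallest size of a set $U\subseteq V(D)$ such that every vertex $v\in V(D)\setminus U$ has some $u\in U$ with $(u,v)\in E(D)$. The underlying undirected graph of $D$ joins two vertices whenever there is an edge between them in $D$ in some direction. *)

theory Defs
  imports "Graph_Theory.Graph_Theory"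
begin

definition independent_set :: "('a, 'b) pre_digraph \<Rightarrow> 'a set \<Rightarrow> bool" where
  "independent_set D S \<longleftrightarrow> S \<subseteq> verts D \<and> (\<forall>u\<in>S. \<forall>v\<in>S. \<not> u \<rightarrow>\<^bsub>D\<^esub> v)"

definition independence_number :: "('a, 'b) pre_digraph \<Rightarrow> nat" where
  "independence_number D = Max (card ` {S. independent_set D S})"

definition dominating_set :: "('a, 'b) pre_digraph \<Rightarrow> 'a set \<Rightarrow> bool" where
  "dominating_set D U \<longleftrightarrow> U \<subseteq> verts D \<and> (\<forall>v\<in>verts D - U. \<exists>u\<in>U. u \<rightarrow>\<^bsub>D\<^esub> v)"

definition domination_number :: "('a, 'b) pre_digraph \<Rightarrow> nat" where
  "domination_number D = Min (card ` {U. dominating_set D U})"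

text \<open>In a loopless digraph the three vertices below are automatically distinct.\<close>

definition clique_acyclic :: "('a, 'b) pre_digraph \<Rightarrow> bool" where
  "clique_acyclic D \<longleftrightarrow> \<not> (\<exists>u v w. u \<rightarrow>\<^bsub>D\<^esub> v \<and> v \<rightarrow>\<^bsub>D\<^esub> w \<and> w \<rightarrow>\<^bsub>D\<^esub> u)"

text \<open>
  The remaining notions concern finite simple undirected graphs, represented as
  finite loopless symmetric digraphs (locale \<^locale>\<open>graph\<close>); the underlying
  undirected graph of a digraph is given by \<^const>\<open>mk_symmetric\<close>.
\<close>

definition clique :: "('a, 'b) pre_digraph \<Rightarrow> 'a set \<Rightarrow> bool" where
  "clique G K \<longleftrightarrow> K \<subseteq> verts G \<and> (\<forall>u\<in>K. \<forall>v\<in>K. u \<noteq> v \<longrightarrow> u \<rightarrow>\<^bsub>G\<^esub> v)"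

definition clique_number :: "('a, 'b) pre_digraph \<Rightarrow> nat" where
  "clique_number G = Max (card ` {K. clique G K})"

definition proper_coloring :: "('a, 'b) pre_digraph \<Rightarrow> nat \<Rightarrow> ('a \<Rightarrow> nat) \<Rightarrow> bool" where
  "proper_coloring G k c \<longleftrightarrow>
    (\<forall>v\<in>verts G. c v < k) \<and> (\<forall>u v. u \<rightarrow>\<^bsub>G\<^esub> v \<longrightarrow> c u \<noteq> c v)"

definition chromatic_number :: "('a, 'b) pre_digraph \<Rightarrow> nat" where
  "chromatic_number G = (LEAST k. \<exists>c. proper_coloring G k c)"

definition perfect :: "('a, 'b) pre_digraph \<Rightarrow> bool" where
  "perfect G \<longleftrightarrow> (\<forall>H. induced_subgraph H G \<longrightarrow> chromatic_number H = clique_number H)"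

end

theory Submission
  imports Defs "HOL-Library.Multiset"
begin

text \<open>
  If the digraph is acyclic, it has a kernel, that is, an independent dominating set
  (\<open>acyclic_kernel\<close>): a source belongs to every kernel, so one takes a source, discards it
  together with its out-neighbours, and continues with the rest. The size of a kernel lies
  between the two numbers.

  If the digraph is clique-acyclic, every nonempty clique of its underlying graph contains a
  vertex that dominates the rest of the clique (\<open>clique_acyclic_dominating_vertex\<close>). Choosing
  such a vertex in each member of a cover of the vertices by cliques gives a dominating set, so
  \<open>\<gamma>\<close> is at most the clique cover number of the underlying graph. What remains is that in a
  perfect graph \<open>\<alpha>\<close> cliques suffice to cover the vertices (\<open>perfect_clique_cover\<close>). This is the
  colouring half of Lovasz's theorem that complements of perfect graphs are perfect.

  The proof of that fact follows the classical one, but instead of replacing each vertex by a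
  clique of copies it gives vertices natural number weights and covers each vertex by as many
  independent sets as its weight demands. For a perfect graph, the number of sets needed is
  the largest weight of a clique (\<open>perfect_weighted_coloring\<close>). Suppose now that for every
  clique \<open>K\<close> some maximum independent set \<open>A K\<close> avoided \<open>K\<close>, and let the weight of a vertex count
  the cliques \<open>K\<close> with \<open>v \<in> A K\<close>. With \<open>m\<close> cliques in total, each clique \<open>X\<close> has weight at most
  \<open>m - 1\<close>, as it meets each \<open>A K\<close> at most once and misses \<open>A X\<close>. So \<open>m - 1\<close> independent sets would
  suffice, although the total weight is \<open>m\<close> times the independence number: a contradiction. Hence
  some clique meets all maximum independent sets; remove it and induct.
\<close>

section \<open>Elementary facts on independent sets and cliques\<close>

lemma independent_set_subset:
  "independent_set D S \<Longrightarrow> T \<subseteq> S \<Longrightarrow> independent_set D T"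
  unfolding independent_set_def by blast

lemma card_clique_Int_independent:
  assumes "clique G K" "independent_set G S"
  shows "card (K \<inter> S) \<le> 1"
proof (cases "K \<inter> S = {}")
  case False
  then obtain x where "x \<in> K \<inter> S" by blast
  then have "K \<inter> S \<subseteq> {x}"
    using assms unfolding clique_def independent_set_def by blast
  from card_mono[OF _ this] show ?thesis by simp
qed simp

lemma (in fin_digraph) card_le_independence_number:
  assumes "independent_set G S"
  shows "card S \<le> independence_number G"
proof -
  have "finite {S. independent_set G S}"
    by (rule finite_subset[of _ "Pow (verts G)"]) (auto simp: independent_set_def)
  then show ?thesis
    using assms unfolding independence_number_def by (intro Max_ge) auto
qed

lemma (in fin_digraph) domination_number_le_card:
  assumes "dominating_set G U"
  shows "domination_number G \<le> card U"
proof -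
  have "finite {U. dominating_set G U}"
    by (rule finite_subset[of _ "Pow (verts G)"]) (auto simp: dominating_set_def)
  then show ?thesis
    using assms unfolding domination_number_def by (intro Min_le) auto
qed


section \<open>Acyclic digraphs have kernels\<close>

lemma (in fin_digraph) acyclic_arcs_ends:
  assumes "\<not> (\<exists>p. cycle p)"
  shows "acyclic (arcs_ends G)"
proof (rule acyclicI, intro allI notI)
  fix v assume "v \<rightarrow>\<^sup>+ v"
  then obtain p where "awalk v p v" "p \<noteq> []"
    by (auto simp: reachable1_awalk)
  then have "closed_w p" by (auto simp: closed_w_def)
  with assms show False using closed_w_imp_cycle by blast
qed

text \<open>
  The set \<open>W\<close> makes induction possible without passing to induced subdigraphs. A source \<open>s\<close> of
  \<open>W\<close> exists as a minimal element of the wellfounded arc relation. A kernel \<open>U\<close> of \<open>W\<close> without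
  \<open>s\<close> and its out-neighbours extends by \<open>s\<close>: no arc leads from \<open>s\<close> to \<open>U\<close> by the choice of the
  remaining vertices, and none leads back since \<open>s\<close> is a source.
\<close>
lemma (in fin_digraph) acyclic_kernel:
  assumes "acyclic (arcs_ends G)" and "W \<subseteq> verts G"
  shows "\<exists>U\<subseteq>W. independent_set G U \<and> (\<forall>v\<in>W - U. \<exists>u\<in>U. u \<rightarrow> v)"
proof -
  have wf: "wf (arcs_ends G)"
    using assms(1) by (intro finite_acyclic_wf) (simp add: arcs_ends_def)
  have "finite W" using assms(2) finite_verts finite_subset by blast
  then show ?thesis
    using assms(2)
  proof (induction W rule: finite_psubset_induct)
    case (psubset W)
    show ?case
    proof (cases "W = {}")
      case True
      then show ?thesis by (auto simp: independent_set_def)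
    next
      case False
      then obtain s where s: "s \<in> W" and source: "\<And>u. u \<rightarrow> s \<Longrightarrow> u \<notin> W"
        using wf by (metis wfE_min ex_in_conv)
      define R where "R = {v \<in> W. v \<noteq> s \<and> \<not> s \<rightarrow> v}"
      have "R \<subset> W" using s by (auto simp: R_def)
      then obtain U where U: "U \<subseteq> R" "independent_set G U" "\<forall>v\<in>R - U. \<exists>u\<in>U. u \<rightarrow> v"
        using psubset.IH[of R] psubset.prems by blast
      have "\<not> s \<rightarrow> u \<and> \<not> u \<rightarrow> s" if "u \<in> insert s U" for u
        using that U(1) s source[of u] source[of s] by (auto simp: R_def)
      moreover have "insert s U \<subseteq> verts G"
        using U(1) s psubset.prems by (auto simp: R_def)
      ultimately have "independent_set G (insert s U)"
        using U(2) unfolding independent_set_def by simp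
      moreover have "\<forall>v\<in>W - insert s U. \<exists>u\<in>insert s U. u \<rightarrow> v"
        using U(3) unfolding R_def by blast
      ultimately show ?thesis
        using U(1) s by (intro exI[of _ "insert s U"]) (auto simp: R_def)
    qed
  qed
qed


section \<open>Weighted colourings of perfect graphs\<close>

text \<open>
  A weighted colouring is a multiset of independent sets, the colour classes, since the same
  class may be used for several colours.
\<close>
definition multiplicity_in :: "'a set multiset \<Rightarrow> 'a \<Rightarrow> nat" where
  "multiplicity_in Ss v = size {#S \<in># Ss. v \<in> S#}"

lemma multiplicity_in_add_mset:
  "multiplicity_in (add_mset S Ss) v = multiplicity_in Ss v + of_bool (v \<in> S)"
  by (simp add: multiplicity_in_def)

lemma multiplicity_in_pos_iff: "0 < multiplicity_in Ss v \<longleftrightarrow> (\<exists>S\<in>#Ss. v \<in> S)"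
  by (induction Ss) (auto simp: multiplicity_in_add_mset, simp add: multiplicity_in_def)

text \<open>
  Double counting of the incidences between \<open>K\<close> and the members of \<open>Ss\<close>. It serves with \<open>b = 1\<close>
  for a clique \<open>K\<close>, and with \<open>b\<close> the independence number when \<open>K\<close> is the whole vertex set
  under consideration.
\<close>
lemma sum_multiplicity_in_le:
  assumes "finite K" and "\<And>S. S \<in># Ss \<Longrightarrow> card (K \<inter> S) \<le> b"
  shows "(\<Sum>v\<in>K. multiplicity_in Ss v) \<le> size Ss * b"
  using assms(2)
proof (induction Ss)
  case empty
  then show ?case by (simp add: multiplicity_in_def)
next
  case (add S Ss)
  have "(\<Sum>v\<in>K. multiplicity_in (add_mset S Ss) v)
      = (\<Sum>v\<in>K. multiplicity_in Ss v) + card (K \<inter> S)"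
    using assms(1) by (simp add: multiplicity_in_add_mset sum.distrib sum_of_bool_eq Int_def)
  also have "\<dots> \<le> size Ss * b + b"
    using add by (intro add_mono) auto
  finally show ?case by simp
qed

context digraph
begin

lemma ex_proper_coloring: "\<exists>k c. proper_coloring G k c"
proof -
  obtain c :: "'a \<Rightarrow> nat" and k where c: "inj_on c (verts G)" "c ` verts G = {i. i < k}"
    using finite_imp_inj_to_nat_seg[OF finite_verts] by metis
  have "c u \<noteq> c v" if "u \<rightarrow> v" for u v
    using that c(1) adj_in_verts[OF that] adj_not_same by (metis inj_on_def)
  then have "proper_coloring G k c"
    using c(2) by (auto simp: proper_coloring_def)
  then show ?thesis by blast
qed

lemma chromatic_coloring: "\<exists>c. proper_coloring G (chromatic_number G) c"
  unfolding chromatic_number_def using ex_proper_coloring by (rule LeastI_ex)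

lemma clique_number_le:
  assumes "\<And>K. clique G K \<Longrightarrow> card K \<le> w"
  shows "clique_number G \<le> w"
proof -
  have "finite {K. clique G K}"
    by (rule finite_subset[of _ "Pow (verts G)"]) (auto simp: clique_def)
  moreover have "clique G {}" by (simp add: clique_def)
  ultimately show ?thesis
    unfolding clique_number_def using assms by (subst Max_le_iff) auto
qed

text \<open>
  Perfection as it is used below, on the vertices of the ambient graph: colourings of an induced
  subgraph become functions on its vertex set, and the clique number is replaced by any upper
  bound \<open>w\<close>.
\<close>
lemma perfect_coloring_subset:
  assumes "perfect G" and "U \<subseteq> verts G"
    and "\<And>K. K \<subseteq> U \<Longrightarrow> clique G K \<Longrightarrow> card K \<le> w"
  shows "\<exists>c. (\<forall>v\<in>U. c v < w) \<and> (\<forall>u\<in>U. \<forall>v\<in>U. u \<rightarrow> v \<longrightarrow> c u \<noteq> c v)"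
proof -
  let ?H = "G \<restriction> U"
  have ind: "induced_subgraph ?H G"
    using assms(2) by (rule induced_induce)
  interpret H: digraph ?H
    using ind by (rule digraphI_induced)
  have adj: "u \<rightarrow>\<^bsub>?H\<^esub> v \<longleftrightarrow> u \<in> U \<and> v \<in> U \<and> u \<rightarrow> v" for u v
    by (auto simp: arcs_ends_conv)
  obtain c where c: "proper_coloring ?H (chromatic_number ?H) c"
    using H.chromatic_coloring by blast
  have "card K \<le> w" if "clique ?H K" for K
    using that assms(2) by (intro assms(3)) (auto simp: clique_def adj)
  then have "chromatic_number ?H \<le> w"
    using assms(1) ind H.clique_number_le unfolding perfect_def by metis
  then have "c v < w" if "v \<in> U" for v
    using c that by (auto simp: proper_coloring_def intro: less_le_trans)
  moreover have "c u \<noteq> c v" if "u \<in> U" "v \<in> U" "u \<rightarrow> v" for u v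
    using c that unfolding proper_coloring_def adj by blast
  ultimately show ?thesis by blast
qed

text \<open>
  This replaces Lovasz's replication lemma. Covering each vertex at least, rather than exactly,
  as often as its weight demands avoids all trimming of colour classes.

  Induction is on the total weight. Weights at most one are an ordinary colouring of the support.
  Otherwise lower the weight of some \<open>x\<close> with \<open>k x \<ge> 2\<close> by one, which keeps it positive, and
  colour. Some colour class \<open>A\<close> contains \<open>x\<close>. Make \<open>A\<close> a class of the new colouring; it remains
  to colour the weights left over by \<open>A\<close> with \<open>w - 1\<close> colours, so every clique has to lose
  weight or be light enough already. A clique containing \<open>x\<close> does lose weight, as \<open>x \<in> A\<close>. A
  clique avoiding \<open>x\<close> is not affected by the lowering at \<open>x\<close>, so the other \<open>w - 1\<close> classes cover
  its remaining weight, and each meets it at most once.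
\<close>
lemma perfect_weighted_coloring:
  assumes "perfect G" and "W \<subseteq> verts G"
    and "\<And>K. K \<subseteq> W \<Longrightarrow> clique G K \<Longrightarrow> sum k K \<le> w"
  shows "\<exists>Ss. size Ss = w \<and> (\<forall>S\<in>#Ss. independent_set G S) \<and> (\<forall>v\<in>W. k v \<le> multiplicity_in Ss v)"
  using assms(3)
proof (induction "sum k W" arbitrary: k w rule: less_induct)
  case less
  have finW: "finite W" using assms(2) finite_verts finite_subset by blast
  show ?case
  proof (cases "\<forall>v\<in>W. k v \<le> 1")
    case True
    define U where "U = {v \<in> W. k v = 1}"
    have "card K \<le> w" if K: "K \<subseteq> U" "clique G K" for K
    proof -
      have "sum k K = sum (\<lambda>_. 1) K" using K(1) by (intro sum.cong) (auto simp: U_def)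
      then show ?thesis using less.prems[of K] K by (auto simp: U_def)
    qed
    then obtain c where c: "\<forall>v\<in>U. c v < w" "\<forall>u\<in>U. \<forall>v\<in>U. u \<rightarrow> v \<longrightarrow> c u \<noteq> c v"
      using perfect_coloring_subset[OF assms(1), of U w] assms(2) by (auto simp: U_def)
    define Ss where "Ss = {#{v \<in> U. c v = i}. i \<in># mset_set {..<w}#}"
    have "size Ss = w" by (simp add: Ss_def)
    moreover have "\<forall>S\<in>#Ss. independent_set G S"
    proof
      fix S assume "S \<in># Ss"
      then obtain i where S: "S = {v \<in> U. c v = i}" by (auto simp: Ss_def)
      have "U \<subseteq> verts G" using assms(2) by (auto simp: U_def)
      then show "independent_set G S"
        using c(2) unfolding S independent_set_def by blast
    qed
    moreover have "k v \<le> multiplicity_in Ss v" if "v \<in> W" for v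
    proof (cases "v \<in> U")
      case True
      then have "0 < multiplicity_in Ss v"
        using c(1) by (auto simp: Ss_def multiplicity_in_pos_iff)
      then show ?thesis using True by (simp add: U_def)
    next
      case False
      then have "k v = 0" using \<open>\<forall>v\<in>W. k v \<le> 1\<close> that by (force simp: U_def)
      then show ?thesis by simp
    qed
    ultimately show ?thesis by blast
  next
    case False
    then obtain x where x: "x \<in> W" "2 \<le> k x" by force
    define k' where "k' = k(x := k x - 1)"
    have k'_le: "k' v \<le> k v" for v by (simp add: k'_def)
    have "sum k' W < sum k W"
      using x finW k'_le by (intro sum_strict_mono_strong[of _ x]) (auto simp: k'_def)
    moreover have "sum k' K \<le> w" if "K \<subseteq> W" "clique G K" for K
      using less.prems[OF that] sum_mono[of K k' k] k'_le by fastforce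
    ultimately obtain Ss where Ss: "size Ss = w" "\<forall>S\<in>#Ss. independent_set G S"
      "\<forall>v\<in>W. k' v \<le> multiplicity_in Ss v"
      using less.hyps[of k' w] by blast
    have "0 < multiplicity_in Ss x" using Ss(3) x by (force simp: k'_def)
    then obtain A where A: "A \<in># Ss" "x \<in> A"
      by (auto simp: multiplicity_in_pos_iff)
    then obtain Rs where Rs: "Ss = add_mset A Rs" by (metis multi_member_split)
    \<comment> \<open>The subtraction is truncated: \<open>A\<close> may contain vertices that are covered more often than
      demanded, even some of weight zero.\<close>
    define k'' where "k'' = (\<lambda>v. k v - of_bool (v \<in> A))"
    have "sum k'' W < sum k W"
      using x A finW by (intro sum_strict_mono_strong[of _ x]) (auto simp: k''_def)
    moreover have "sum k'' K \<le> size Rs" if K: "K \<subseteq> W" "clique G K" for K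
    proof (cases "x \<in> K")
      case True
      have "sum k'' K < sum k K"
        using x A True finite_subset[OF K(1) finW]
        by (intro sum_strict_mono_strong[of _ x]) (auto simp: k''_def)
      also have "\<dots> \<le> w" using less.prems K by blast
      finally show ?thesis using Ss(1) Rs by simp
    next
      case False
      have "k'' v \<le> multiplicity_in Rs v" if "v \<in> K" for v
      proof -
        have "v \<in> W" "v \<noteq> x" using that K(1) False by auto
        then have "k v \<le> multiplicity_in Ss v" using Ss(3) by (auto simp: k'_def)
        then show ?thesis by (simp add: k''_def Rs multiplicity_in_add_mset)
      qed
      then have "sum k'' K \<le> (\<Sum>v\<in>K. multiplicity_in Rs v)" by (rule sum_mono)
      also have "\<dots> \<le> size Rs * 1"
        using K Ss(2) Rs finite_subset[OF K(1) finW]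
        by (intro sum_multiplicity_in_le card_clique_Int_independent) auto
      finally show ?thesis by simp
    qed
    ultimately obtain Ts where Ts: "size Ts = size Rs" "\<forall>S\<in>#Ts. independent_set G S"
      "\<forall>v\<in>W. k'' v \<le> multiplicity_in Ts v"
      using less.hyps[of k'' "size Rs"] by blast
    have "k v \<le> multiplicity_in (add_mset A Ts) v" if "v \<in> W" for v
      using bspec[OF Ts(3) that] by (auto simp: k''_def multiplicity_in_add_mset)
    then show ?thesis
      using Ts(1,2) Ss(1,2) Rs by (intro exI[of _ "add_mset A Ts"]) auto
  qed
qed


section \<open>Clique covers of perfect graphs\<close>

text \<open>
  A clique whose removal lowers the independence number. Were there none, the weights \<open>k\<close> counting
  how often a vertex lies in the sets \<open>A K\<close> would contradict \<open>perfect_weighted_coloring\<close>.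
\<close>
lemma perfect_clique_meeting_large_independent_sets:
  assumes "perfect G" and "W \<subseteq> verts G"
    and ind: "\<And>S. S \<subseteq> W \<Longrightarrow> independent_set G S \<Longrightarrow> card S \<le> Suc a"
  shows "\<exists>K\<subseteq>W. clique G K \<and> (\<forall>S\<subseteq>W - K. independent_set G S \<longrightarrow> card S \<le> a)"
proof (rule ccontr)
  assume "\<not> ?thesis"
  then have "\<forall>K. K \<subseteq> W \<and> clique G K \<longrightarrow>
      (\<exists>S. S \<subseteq> W - K \<and> independent_set G S \<and> \<not> card S \<le> a)"
    by blast
  then obtain A where A: "\<And>K. K \<subseteq> W \<Longrightarrow> clique G K \<Longrightarrow>
      A K \<subseteq> W - K \<and> independent_set G (A K) \<and> \<not> card (A K) \<le> a"
    by metis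
  have finW: "finite W" using assms(2) finite_verts finite_subset by blast
  define C where "C = {K. K \<subseteq> W \<and> clique G K}"
  have finC: "finite C" using finW by (auto simp: C_def)
  \<comment> \<open>This makes \<open>card C\<close> positive, so that \<open>card C - 1\<close> is a proper decrease.\<close>
  have "{} \<in> C" by (simp add: C_def clique_def)
  define k where "k = (\<lambda>v. card {K \<in> C. v \<in> A K})"
  have sum_k: "sum k X = (\<Sum>K\<in>C. card (X \<inter> A K))" if "X \<subseteq> W" for X
  proof -
    have "finite X" using that finW finite_subset by blast
    have "sum k X = (\<Sum>v\<in>X. \<Sum>K\<in>C. of_bool (v \<in> A K))"
      using finC by (simp add: k_def sum_of_bool_eq Int_def)
    also have "\<dots> = (\<Sum>K\<in>C. \<Sum>v\<in>X. of_bool (v \<in> A K))" by (rule sum.swap)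
    also have "\<dots> = (\<Sum>K\<in>C. card (X \<inter> A K))"
      using \<open>finite X\<close> by (simp add: sum_of_bool_eq Int_def)
    finally show ?thesis .
  qed
  have "sum k X \<le> card C - 1" if X: "X \<subseteq> W" "clique G X" for X
  proof -
    have "X \<in> C" using X by (simp add: C_def)
    have "X \<inter> A X = {}" using A[OF X] by blast
    then have "sum k X = (\<Sum>K\<in>C - {X}. card (X \<inter> A K))"
      unfolding sum_k[OF X(1)] sum.remove[OF finC \<open>X \<in> C\<close>] by simp
    also have "\<dots> \<le> (\<Sum>K\<in>C - {X}. 1)"
      using A X by (intro sum_mono card_clique_Int_independent) (auto simp: C_def)
    finally show ?thesis using \<open>X \<in> C\<close> finC by simp
  qed
  then obtain Ss where Ss: "size Ss = card C - 1" "\<forall>S\<in>#Ss. independent_set G S"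
      "\<forall>v\<in>W. k v \<le> multiplicity_in Ss v"
    using perfect_weighted_coloring[OF assms(1,2)] by blast
  have "card C * Suc a = (\<Sum>K\<in>C. Suc a)" by simp
  also have "\<dots> \<le> (\<Sum>K\<in>C. card (W \<inter> A K))"
  proof (rule sum_mono)
    fix K assume "K \<in> C"
    then have "A K \<subseteq> W - K" "\<not> card (A K) \<le> a" using A by (auto simp: C_def)
    moreover from this have "W \<inter> A K = A K" by blast
    ultimately show "Suc a \<le> card (W \<inter> A K)" by simp
  qed
  also have "\<dots> = sum k W" by (simp add: sum_k)
  also have "\<dots> \<le> (\<Sum>v\<in>W. multiplicity_in Ss v)" using Ss(3) by (intro sum_mono) auto
  also have "\<dots> \<le> size Ss * Suc a"
    using Ss(2) finW by (intro sum_multiplicity_in_le ind) (auto intro: independent_set_subset)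
  finally have "card C * Suc a \<le> (card C - 1) * Suc a" using Ss(1) by simp
  moreover have "card C - 1 < card C"
    using \<open>{} \<in> C\<close> finC card_gt_0_iff[of C] by auto
  then have "(card C - 1) * Suc a < card C * Suc a" by (rule mult_strict_right_mono) simp
  ultimately show False by simp
qed

lemma perfect_clique_cover:
  assumes "perfect G" and "W \<subseteq> verts G"
    and "\<And>S. S \<subseteq> W \<Longrightarrow> independent_set G S \<Longrightarrow> card S \<le> a"
  shows "\<exists>C. finite C \<and> card C \<le> a \<and> (\<forall>K\<in>C. clique G K) \<and> W \<subseteq> \<Union>C"
  using assms(2,3)
proof (induction a arbitrary: W)
  case 0
  have "False" if "v \<in> W" for v
    using "0.prems"(2)[of "{v}"] "0.prems"(1) that adj_not_same by (auto simp: independent_set_def)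
  then show ?case by (intro exI[of _ "{}"]) auto
next
  case (Suc a)
  obtain K where K: "K \<subseteq> W" "clique G K"
    "\<And>S. S \<subseteq> W - K \<Longrightarrow> independent_set G S \<Longrightarrow> card S \<le> a"
    using perfect_clique_meeting_large_independent_sets[OF assms(1) Suc.prems] by blast
  have "W - K \<subseteq> verts G" using Suc.prems(1) by blast
  from Suc.IH[OF this K(3)]
  obtain C where C: "finite C" "card C \<le> a" "\<forall>K\<in>C. clique G K" "W - K \<subseteq> \<Union>C"
    by auto
  then show ?case
    using K(2) by (intro exI[of _ "insert K C"]) (auto simp: card_insert_if)
qed


section \<open>Cliques in clique-acyclic digraphs\<close>

text \<open>
  A vertex \<open>v\<close> with most out-neighbours within \<open>K\<close> dominates \<open>K\<close>. If it did not dominate \<open>u\<close>,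
  then \<open>u \<rightarrow> v\<close>, and \<open>u\<close> would also dominate each out-neighbour \<open>w\<close> of \<open>v\<close>, because the arc
  from \<open>w\<close> to \<open>u\<close> would close a directed triangle. Then \<open>u\<close> would have more out-neighbours
  than \<open>v\<close>, namely \<open>v\<close> itself in addition.
\<close>
lemma clique_acyclic_dominating_vertex:
  assumes "clique_acyclic G" and "finite K" "K \<noteq> {}"
    and adj: "\<And>u v. u \<in> K \<Longrightarrow> v \<in> K \<Longrightarrow> u \<noteq> v \<Longrightarrow> u \<rightarrow> v \<or> v \<rightarrow> u"
  shows "\<exists>v\<in>K. \<forall>u\<in>K - {v}. v \<rightarrow> u"
proof -
  define N where "N = (\<lambda>v. {w \<in> K. v \<rightarrow> w})"
  have "Max ((card \<circ> N) ` K) \<in> (card \<circ> N) ` K"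
    using assms(2,3) by (intro Max_in) auto
  then obtain v where "v \<in> K" and "card (N v) = Max ((card \<circ> N) ` K)" by auto
  then have v: "v \<in> K" "\<And>u. u \<in> K \<Longrightarrow> card (N u) \<le> card (N v)"
    using assms(2) by auto
  have "v \<rightarrow> u" if u: "u \<in> K" "u \<noteq> v" for u
  proof (rule ccontr)
    assume "\<not> v \<rightarrow> u"
    then have "u \<rightarrow> v" using adj u v(1) by blast
    have "u \<rightarrow> w" if "w \<in> N v" for w
      using that \<open>u \<rightarrow> v\<close> \<open>\<not> v \<rightarrow> u\<close> adj[of u w] u(1) assms(1)
      unfolding N_def clique_acyclic_def by blast
    then have "insert v (N v) \<subseteq> N u"
      using \<open>u \<rightarrow> v\<close> v(1) by (auto simp: N_def)
    moreover have "v \<notin> N v" using adj_not_same by (auto simp: N_def)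
    ultimately have "N v \<subset> N u" by blast
    then have "card (N v) < card (N u)"
      using assms(2) by (intro psubset_card_mono) (auto simp: N_def)
    then show False using v(2)[OF u(1)] by simp
  qed
  then show ?thesis using v(1) by blast
qed

lemma domination_number_le_clique_cover:
  assumes "clique_acyclic G" and "finite C"
    and cl: "\<forall>K\<in>C. clique (with_proj (mk_symmetric G)) K" and "verts G \<subseteq> \<Union>C"
  shows "domination_number G \<le> card C"
proof -
  have "\<exists>v\<in>K. \<forall>u\<in>K - {v}. v \<rightarrow> u" if "K \<in> C - {{}}" for K
  proof (rule clique_acyclic_dominating_vertex[OF assms(1)])
    have K: "clique (with_proj (mk_symmetric G)) K" using cl that by blast
    then show "finite K" using finite_subset[OF _ finite_verts] by (auto simp: clique_def)
    show "K \<noteq> {}" using that by blast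
    show "u \<rightarrow> v \<or> v \<rightarrow> u" if "u \<in> K" "v \<in> K" "u \<noteq> v" for u v
      using K that by (force simp: clique_def parcs_mk_symmetric arcs_ends_conv)
  qed
  \<comment> \<open>The cover may contain the empty clique, which has no vertex to contribute.\<close>
  then obtain d where d: "\<And>K. K \<in> C - {{}} \<Longrightarrow> d K \<in> K \<and> (\<forall>u\<in>K - {d K}. d K \<rightarrow> u)"
    by metis
  let ?U = "d ` (C - {{}})"
  have "dominating_set G ?U"
    unfolding dominating_set_def
  proof (intro conjI ballI)
    show "?U \<subseteq> verts G" using d cl by (fastforce simp: clique_def)
    fix v assume v: "v \<in> verts G - ?U"
    then obtain K where "K \<in> C - {{}}" "v \<in> K" using assms(4) by blast
    with d[of K] v show "\<exists>u\<in>?U. u \<rightarrow> v" by blast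
  qed
  then have "domination_number G \<le> card ?U" by (rule domination_number_le_card)
  also have "\<dots> \<le> card (C - {{}})" using assms(2) by (intro card_image_le) simp
  also have "\<dots> \<le> card C" using assms(2) by (intro card_mono) auto
  finally show ?thesis .
qed

end

section \<open>Domination and independence\<close>

lemma (in digraph) digraph_with_proj_mk_symmetric:
  "digraph (with_proj (mk_symmetric G))"
proof -
  interpret S: pair_digraph "mk_symmetric G" by (rule digraph_mk_symmetric)
  show ?thesis by unfold_locales
qed

lemma independent_set_mk_symmetric:
  "independent_set (with_proj (mk_symmetric D)) S \<longleftrightarrow> independent_set D S"
  by (auto simp: independent_set_def parcs_mk_symmetric arcs_ends_conv)

theorem proposition5:
  fixes D :: "('a, 'b) pre_digraph"
  assumes "digraph D"
    and "\<not> (\<exists>p. pre_digraph.cycle D p) \<or>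
         (clique_acyclic D \<and> perfect (with_proj (mk_symmetric D)))"
  shows "domination_number D \<le> independence_number D"
proof -
  interpret D: digraph D by fact
  from assms(2) show ?thesis
  proof
    assume "\<not> (\<exists>p. pre_digraph.cycle D p)"
    then obtain U where U: "independent_set D U" "U \<subseteq> verts D" "\<forall>v\<in>verts D - U. \<exists>u\<in>U. u \<rightarrow>\<^bsub>D\<^esub> v"
      using D.acyclic_kernel[OF D.acyclic_arcs_ends] by blast
    then have "domination_number D \<le> card U"
      by (intro D.domination_number_le_card) (simp add: dominating_set_def)
    also have "\<dots> \<le> independence_number D"
      using U(1) by (rule D.card_le_independence_number)
    finally show ?thesis .
  next
    assume asm: "clique_acyclic D \<and> perfect (with_proj (mk_symmetric D))"
    interpret S: digraph "with_proj (mk_symmetric D)"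
      by (rule D.digraph_with_proj_mk_symmetric)
    obtain C where C: "finite C" "card C \<le> independence_number D"
      "\<forall>K\<in>C. clique (with_proj (mk_symmetric D)) K" "verts D \<subseteq> \<Union>C"
      using S.perfect_clique_cover[of "verts D" "independence_number D"] asm
        D.card_le_independence_number by (auto simp: independent_set_mk_symmetric)
    have "domination_number D \<le> card C"
      using asm C by (intro D.domination_number_le_clique_cover) auto
    with C(2) show ?thesis by simp
  qed
qed

end
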